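(* The Ord-CCWL test is strictly more expressive than the $k$-CCWL test. That is: (i) every pair of finite labeled combinatorial complexes with ordered neighborhoods that is distinguished by the $k$-CCWL test is also distinguished by the Ord-CCWL test; and (ii) there exists a pair of finite labeled combinatorial complexes with ordered neighborhoods that is distinguished by the Ord-CCWL test but is not distinguished by the $k$-CCWL test.
   Context: A combinatorial complex is a triple $(\mathcal{V},\mathcal{C},\mathrm{rk})$ where $\mathcal{V}$ is a set, $\mathcal{C}\subseteq\mathcal{P}(\mathcal{V})\setminus\{\emptyset\}$, and $\mathrm{rk}:\mathcal{C}\to\mathbb{Z}_{\ge 0}$ satisfies: (1) for all $v\in\mathcal{V}$, $\{v\}\in\mathcal{C}$ and $\mathrm{rk}(\{v\})=0$; (2) if $\sigma\subseteq\tau$ with $\sigma,\tau\in\mathcal{C}$ then $\mathrm{rk}(\sigma)\le\mathrm{rk}(\tau)$. Elements of $\mathcal{C}$ are called cells. A neighborhood on $\mathcal{C}$ is a function $\mathcal{N}:\mathcal{C}\to\mathcal{P}(\mathcal{C})$. A labeled combinatorial complex $(\mathcal{C},\ell)$ is a combinatorial complex with a function $\ell$ from $\mathcal{C}$ to a fixed set of labels. "With ordered neighborhoods" means that it is equipped with a neighborhood $\mathcal{N}$ and, for every cell $\sigma$, a total order $\le_\sigma$ on the finite set $\mathcal{N}(\sigma)$. Ord-CCWL test. Colors are initialized by $c^0_{\sigma}=\ell(\sigma)$ for all $\sigma\in\mathcal{C}$. Given the colors at iteration $t$, set $$c^{t}_{\mathcal{N}}(\sigma)=\big(c^t_{\sigma'}\;:\;\sigma'\in\mathcal{N}(\sigma)\big)\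 \text{ (a tuple, listed in increasing order for } \le_\sigma),\qquad c^{t+1}_{\sigma}=\mathrm{HASH}\big(c^t_\sigma,c^t_{\mathcal{N}}(\sigma)\big),$$ where $\mathrm{HASH}$ is a perfect (injective) hash function, the same for all complexes. The algorithm stops when an iteration leaves the coloring (i.e. the induced partition of cells) unchanged. $k$-CCWL test. The same scheme, the only difference being that $c^{t}_{\mathcal{N}}(\sigma)$ is the multiset $\{\!\{c^t_{\sigma'} : \sigma'\in\mathcal{N}(\sigma)\}\!\}$ instead of the tuple; in particular it ignores the orders $\le_\sigma$. A test distinguishes two labeled combinatorial complexes if, at some iteration $t$, the multisets of colors $\{\!\{c^t_\sigma:\sigma\in\mathcal{C}\}\!\}$ of the two complexes differ. Test $A$ is strictly more expressive than test $B$ if $A$ distinguishes every pair that $B$ distinguishes, and $A$ distinguishes some pair that $B$ does not. *)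

theory Defs
  imports "HOL-Library.Multiset"
begin

record 'v comb_complex =
  vertices :: "'v set"
  cells :: "'v set set"
  rk :: "'v set \<Rightarrow> nat"

definition combinatorial_complex :: "('v, 'z) comb_complex_scheme \<Rightarrow> bool" where
  "combinatorial_complex X \<longleftrightarrow>
     cells X \<subseteq> Pow (vertices X) - {{}} \<and>
     (\<forall>v\<in>vertices X. {v} \<in> cells X \<and> rk X {v} = 0) \<and>
     (\<forall>\<sigma>\<in>cells X. \<forall>\<tau>\<in>cells X. \<sigma> \<subseteq> \<tau> \<longrightarrow> rk X \<sigma> \<le> rk X \<tau>)"

text \<open>Labels are also the colors of iteration 0, so they live in the type \<open>'c\<close> of colors.
  \<open>ord X \<sigma>\<close> is the order on \<open>nbhd X \<sigma>\<close>, as a set of pairs \<open>(smaller, larger)\<close>.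
  The functions \<open>rk\<close>, \<open>label\<close>, \<open>nbhd\<close> and \<open>ord\<close> are relevant on cells only.\<close>

record ('v, 'c) ord_complex = "'v comb_complex" +
  label :: "'v set \<Rightarrow> 'c"
  nbhd :: "'v set \<Rightarrow> 'v set set"
  ord :: "'v set \<Rightarrow> 'v set rel"

definition labeled_ord_complex :: "'c set \<Rightarrow> ('v, 'c) ord_complex \<Rightarrow> bool" where
  "labeled_ord_complex L X \<longleftrightarrow>
     combinatorial_complex X \<and>
     (\<forall>\<sigma>\<in>cells X. label X \<sigma> \<in> L) \<and>
     (\<forall>\<sigma>\<in>cells X. nbhd X \<sigma> \<subseteq> cells X \<and> finite (nbhd X \<sigma>) \<and>
        linear_order_on (nbhd X \<sigma>) (ord X \<sigma>))"

definition finite_labeled_ord_complex :: "'c set \<Rightarrow> ('v, 'c) ord_complex \<Rightarrow> bool" where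
  "finite_labeled_ord_complex L X \<longleftrightarrow> labeled_ord_complex L X \<and> finite (vertices X)"

definition nbhd_list :: "('v, 'c) ord_complex \<Rightarrow> 'v set \<Rightarrow> 'v set list" where
  "nbhd_list X \<sigma> =
     (THE xs. distinct xs \<and> set xs = nbhd X \<sigma> \<and> sorted_wrt (\<lambda>\<tau> \<tau>'. (\<tau>, \<tau>') \<in> ord X \<sigma>) xs)"

primrec ord_ccwl_color ::
    "('c \<times> 'c list \<Rightarrow> 'c) \<Rightarrow> ('v, 'c) ord_complex \<Rightarrow> nat \<Rightarrow> 'v set \<Rightarrow> 'c" where
  "ord_ccwl_color H X 0 = label X"
| "ord_ccwl_color H X (Suc t) =
     (\<lambda>\<sigma>. H (ord_ccwl_color H X t \<sigma>, map (ord_ccwl_color H X t) (nbhd_list X \<sigma>)))"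

primrec k_ccwl_color ::
    "('c \<times> 'c multiset \<Rightarrow> 'c) \<Rightarrow> ('v, 'c) ord_complex \<Rightarrow> nat \<Rightarrow> 'v set \<Rightarrow> 'c" where
  "k_ccwl_color H X 0 = label X"
| "k_ccwl_color H X (Suc t) =
     (\<lambda>\<sigma>. H (k_ccwl_color H X t \<sigma>, image_mset (k_ccwl_color H X t) (mset_set (nbhd X \<sigma>))))"

definition color_partition :: "'a set \<Rightarrow> ('a \<Rightarrow> 'c) \<Rightarrow> 'a set set" where
  "color_partition A c = (\<lambda>\<sigma>. {\<tau> \<in> A. c \<tau> = c \<sigma>}) ` A"

text \<open>Iteration \<open>t\<close> is performed if the algorithm has not stopped before it; the iteration that
  is found to leave the partition unchanged is itself the last one performed.\<close>

definition performed :: "'a set \<Rightarrow> (nat \<Rightarrow> 'a \<Rightarrow> 'c) \<Rightarrow> nat \<Rightarrow> bool" where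
  "performed A c t \<longleftrightarrow>
     (\<forall>s. Suc s < t \<longrightarrow> color_partition A (c (Suc s)) \<noteq> color_partition A (c s))"

definition distinguished ::
    "'a set \<Rightarrow> (nat \<Rightarrow> 'a \<Rightarrow> 'c) \<Rightarrow> 'b set \<Rightarrow> (nat \<Rightarrow> 'b \<Rightarrow> 'c) \<Rightarrow> bool" where
  "distinguished A c B d \<longleftrightarrow>
     (\<exists>t. performed A c t \<and> performed B d t \<and>
        image_mset (c t) (mset_set A) \<noteq> image_mset (d t) (mset_set B))"

definition ord_ccwl_distinguishes ::
    "('c \<times> 'c list \<Rightarrow> 'c) \<Rightarrow> ('v, 'c) ord_complex \<Rightarrow> ('w, 'c) ord_complex \<Rightarrow> bool" where
  "ord_ccwl_distinguishes H X Y \<longleftrightarrow>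
     distinguished (cells X) (ord_ccwl_color H X) (cells Y) (ord_ccwl_color H Y)"

definition k_ccwl_distinguishes ::
    "('c \<times> 'c multiset \<Rightarrow> 'c) \<Rightarrow> ('v, 'c) ord_complex \<Rightarrow> ('w, 'c) ord_complex \<Rightarrow> bool" where
  "k_ccwl_distinguishes H X Y \<longleftrightarrow>
     distinguished (cells X) (k_ccwl_color H X) (cells Y) (k_ccwl_color H Y)"

end

theory Submission
  imports Defs
begin

text \<open>Both tests are governed by functions of colors that do not depend on the complex, because a
  hash value determines its arguments. Hence one function computes the k-CCWL color from the
  Ord-CCWL color in every complex, so equal Ord-CCWL multisets give equal k-CCWL multisets. The only
  obstacle is that Ord-CCWL may stop earlier: if the partition of one complex is unchanged by an
  iteration at which the two complexes still agree, then the new color is the same function of the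
  old color in both of them, and this persists, so the complexes would agree at every later
  iteration as well. Strictness is witnessed by a single complex with one label, whose three cells
  have neighborhoods of different sizes, taken with two opposite orders.\<close>

section \<open>Enumerating a finite linear order as a list\<close>

text \<open>If the heads differed, each would occur in the tail of the other list, so the two would
  be related in both directions.\<close>

lemma sorted_wrt_antisym_unique:
  assumes "antisym r"
    and "distinct xs" "sorted_wrt (\<lambda>x y. (x, y) \<in> r) xs"
    and "distinct ys" "sorted_wrt (\<lambda>x y. (x, y) \<in> r) ys"
    and "set xs = set ys"
  shows "xs = ys"
  using assms(2-)
proof (induction xs arbitrary: ys)
  case (Cons x xs)
  then obtain y ys' where ys: "ys = y # ys'" by (cases ys) auto
  have "x = y"
  proof (rule ccontr)
    assume "x \<noteq> y"
    then have "y \<in> set xs" "x \<in> set ys'" using Cons.prems ys by auto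
    then have "(x, y) \<in> r" "(y, x) \<in> r" using Cons.prems ys by auto
    with \<open>antisym r\<close> \<open>x \<noteq> y\<close> show False by (auto dest: antisymD)
  qed
  moreover have "set xs = set ys'"
    using Cons.prems ys \<open>x = y\<close> by (auto simp: insert_ident)
  ultimately show ?case using Cons ys by auto
qed simp

lemma sorted_wrt_linear_order_exists:
  assumes "finite F" "F \<subseteq> A" "linear_order_on A r"
  shows "\<exists>xs. distinct xs \<and> set xs = F \<and> sorted_wrt (\<lambda>x y. (x, y) \<in> r) xs"
  using assms(1,2)
proof (induction F)
  case (insert x F)
  then obtain xs where xs: "distinct xs" "set xs = F" "sorted_wrt (\<lambda>x y. (x, y) \<in> r) xs"
    by auto
  have r: "trans r" "total_on A r"
    using assms(3) by (auto simp: order_on_defs)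
  \<comment> \<open>The new element goes after everything below it; totality puts the remaining
    elements above it, and transitivity relates the two filtered parts.\<close>
  let ?ys = "filter (\<lambda>y. (y, x) \<in> r) xs @ x # filter (\<lambda>y. (y, x) \<notin> r) xs"
  have above: "(x, z) \<in> r" if "z \<in> F" "(z, x) \<notin> r" for z
    using that insert r(2) by (auto simp: total_on_def)
  have "distinct ?ys" "set ?ys = insert x F"
    using xs insert.hyps by auto
  moreover have "sorted_wrt (\<lambda>x y. (x, y) \<in> r) ?ys"
    using xs above r(1) by (auto simp: sorted_wrt_append sorted_wrt_filter dest: transD)
  ultimately show ?case by blast
qed simp

lemma nbhd_list_eqI:
  assumes "antisym (ord X \<sigma>)" "distinct xs" "set xs = nbhd X \<sigma>"
    and "sorted_wrt (\<lambda>\<tau> \<tau>'. (\<tau>, \<tau>') \<in> ord X \<sigma>) xs"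
  shows "nbhd_list X \<sigma> = xs"
  unfolding nbhd_list_def
  using assms by (intro the_equality) (auto intro: sorted_wrt_antisym_unique)

lemma nbhd_list_correct:
  assumes "labeled_ord_complex L X" "\<sigma> \<in> cells X"
  shows "distinct (nbhd_list X \<sigma>)" "set (nbhd_list X \<sigma>) = nbhd X \<sigma>"
proof -
  have fin: "finite (nbhd X \<sigma>)" and lin: "linear_order_on (nbhd X \<sigma>) (ord X \<sigma>)"
    using assms by (auto simp: labeled_ord_complex_def)
  obtain xs where xs: "distinct xs" "set xs = nbhd X \<sigma>"
      "sorted_wrt (\<lambda>\<tau> \<tau>'. (\<tau>, \<tau>') \<in> ord X \<sigma>) xs"
    using sorted_wrt_linear_order_exists[OF fin order_refl lin] by auto
  moreover have "antisym (ord X \<sigma>)" using lin by (simp add: order_on_defs)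
  ultimately have "nbhd_list X \<sigma> = xs" by (intro nbhd_list_eqI)
  with xs show "distinct (nbhd_list X \<sigma>)" "set (nbhd_list X \<sigma>) = nbhd X \<sigma>" by auto
qed

lemma nbhd_list_subset_cells:
  assumes "labeled_ord_complex L X" "\<sigma> \<in> cells X"
  shows "set (nbhd_list X \<sigma>) \<subseteq> cells X"
  using assms nbhd_list_correct(2)[OF assms] by (auto simp: labeled_ord_complex_def)

lemma mset_nbhd_list:
  assumes "labeled_ord_complex L X" "\<sigma> \<in> cells X"
  shows "mset (nbhd_list X \<sigma>) = mset_set (nbhd X \<sigma>)"
  using nbhd_list_correct[OF assms] mset_set_set by metis

lemma finite_cells:
  "finite_labeled_ord_complex L X \<Longrightarrow> finite (cells X)"
  unfolding finite_labeled_ord_complex_def labeled_ord_complex_def combinatorial_complex_def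
  by (meson Diff_subset finite_Pow_iff finite_subset)

section \<open>Translating Ord-CCWL colors into k-CCWL colors\<close>

text \<open>The translation takes no complex as argument, so the same one serves both complexes
  under comparison. It starts with \<open>id\<close> because both tests start from the labels; at
  later iterations its values off the range of \<open>H\<close> are arbitrary.\<close>

primrec coarsen :: "('c \<times> 'c list \<Rightarrow> 'c) \<Rightarrow> ('c \<times> 'c multiset \<Rightarrow> 'c) \<Rightarrow> nat \<Rightarrow> 'c \<Rightarrow> 'c" where
  "coarsen H K 0 = id"
| "coarsen H K (Suc t) =
     (\<lambda>x. case inv H x of (a, as) \<Rightarrow> K (coarsen H K t a, mset (map (coarsen H K t) as)))"

text \<open>Injectivity lets \<open>inv H\<close> recover the previous color and the tuple of
  neighbor colors; the multiset of the k-CCWL test is that tuple with its order forgotten.\<close>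

lemma k_color_eq_coarsen_ord_color:
  assumes "inj H" "labeled_ord_complex L X" "\<sigma> \<in> cells X"
  shows "k_ccwl_color K X t \<sigma> = coarsen H K t (ord_ccwl_color H X t \<sigma>)"
  using assms(3)
proof (induction t arbitrary: \<sigma>)
  case (Suc t)
  have "image_mset (k_ccwl_color K X t) (mset_set (nbhd X \<sigma>)) =
        mset (map (k_ccwl_color K X t) (nbhd_list X \<sigma>))"
    using mset_nbhd_list[OF assms(2) Suc.prems] by simp
  also have "map (k_ccwl_color K X t) (nbhd_list X \<sigma>) =
        map (coarsen H K t) (map (ord_ccwl_color H X t) (nbhd_list X \<sigma>))"
    using nbhd_list_subset_cells[OF assms(2) Suc.prems] Suc.IH by auto
  finally show ?case using Suc \<open>inj H\<close> by (simp add: multiset.map_comp)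
qed simp

section \<open>Stable partitions and stopping\<close>

text \<open>Each class of \<open>c\<close> is also a class of \<open>c'\<close>, so
  \<open>c'\<close> is constant on it. This turns stability, a property of one complex, into a map
  of colors that can be carried to another complex.\<close>

lemma color_partition_eq_factor:
  assumes "color_partition A c' = color_partition A c"
  obtains g where "\<And>x. x \<in> A \<Longrightarrow> c' x = g (c x)"
proof -
  have same: "c' x = c' y" if "x \<in> A" "y \<in> A" "c x = c y" for x y
  proof -
    have "{z \<in> A. c z = c x} \<in> color_partition A c'"
      using assms that by (auto simp: color_partition_def)
    then obtain w where "{z \<in> A. c z = c x} = {z \<in> A. c' z = c' w}"
      by (auto simp: color_partition_def)
    with that have "x \<in> {z \<in> A. c' z = c' w}" "y \<in> {z \<in> A. c' z = c' w}" by auto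
    then show ?thesis by simp
  qed
  define g where "g u = c' (SOME x. x \<in> A \<and> c x = u)" for u
  have "c' x = g (c x)" if "x \<in> A" for x
    unfolding g_def using that by (rule_tac someI2[of _ x]) (auto intro: same)
  then show thesis by (rule that)
qed

text \<open>The factor for the next iteration is built from \<open>H\<close> and \<open>g\<close>
  alone, so complexes that share \<open>g\<close> share it too.\<close>

lemma ord_color_factor_persists:
  assumes "inj H" "labeled_ord_complex L X"
    and "\<And>\<sigma>. \<sigma> \<in> cells X \<Longrightarrow> ord_ccwl_color H X (Suc s) \<sigma> = g (ord_ccwl_color H X s \<sigma>)"
    and "\<sigma> \<in> cells X"
  shows "ord_ccwl_color H X (Suc (Suc s)) \<sigma> =
    (case inv H (ord_ccwl_color H X (Suc s) \<sigma>) of (a, as) \<Rightarrow> H (g a, map g as))"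
proof -
  have "map (ord_ccwl_color H X (Suc s)) (nbhd_list X \<sigma>) =
      map g (map (ord_ccwl_color H X s) (nbhd_list X \<sigma>))"
    using nbhd_list_subset_cells[OF assms(2,4)] assms(3) by auto
  then have "ord_ccwl_color H X (Suc (Suc s)) \<sigma> =
      H (g (ord_ccwl_color H X s \<sigma>), map g (map (ord_ccwl_color H X s) (nbhd_list X \<sigma>)))"
    using assms(3)[OF assms(4)] by (simp only: ord_ccwl_color.simps(2)[of H X "Suc s"])
  then show ?thesis using \<open>inj H\<close> by simp
qed

text \<open>\<open>performed\<close> is left out so that agreement can be followed past the stopping
  point.\<close>

definition ord_agree ::
    "('c \<times> 'c list \<Rightarrow> 'c) \<Rightarrow> ('v, 'c) ord_complex \<Rightarrow> ('w, 'c) ord_complex \<Rightarrow> nat \<Rightarrow> bool" where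
  "ord_agree H X Y t \<longleftrightarrow>
     image_mset (ord_ccwl_color H X t) (mset_set (cells X)) =
     image_mset (ord_ccwl_color H Y t) (mset_set (cells Y))"

lemma image_mset_factor:
  assumes "\<And>x. x \<in> A \<Longrightarrow> f x = g (h x)"
  shows "image_mset f (mset_set A) = image_mset g (image_mset h (mset_set A))"
  \<comment> \<open>For infinite \<open>A\<close> both sides are empty, as \<open>mset_set A\<close>
    is then \<open>{#}\<close>.\<close>
  by (cases "finite A") (auto simp: assms multiset.map_comp intro!: image_mset_cong)

text \<open>Mapping both multisets by the common \<open>g\<close> preserves their equality. The
  induction generalizes \<open>g\<close> because the factor may change at each iteration.\<close>

lemma ord_agree_factor:
  assumes "inj H" "labeled_ord_complex L X" "labeled_ord_complex L Y"
    and "ord_agree H X Y s"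
    and "\<And>\<sigma>. \<sigma> \<in> cells X \<Longrightarrow> ord_ccwl_color H X (Suc s) \<sigma> = g (ord_ccwl_color H X s \<sigma>)"
    and "\<And>\<sigma>. \<sigma> \<in> cells Y \<Longrightarrow> ord_ccwl_color H Y (Suc s) \<sigma> = g (ord_ccwl_color H Y s \<sigma>)"
  shows "ord_agree H X Y (s + n)"
  using assms(4-)
proof (induction n arbitrary: s g)
  case (Suc n)
  have "ord_agree H X Y (Suc s)"
    using Suc.prems(1)
      image_mset_factor[of "cells X" "ord_ccwl_color H X (Suc s)" g, OF Suc.prems(2)]
      image_mset_factor[of "cells Y" "ord_ccwl_color H Y (Suc s)" g, OF Suc.prems(3)]
    by (simp add: ord_agree_def del: ord_ccwl_color.simps)
  from Suc.IH[OF this ord_color_factor_persists[OF assms(1,2) Suc.prems(2)]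
      ord_color_factor_persists[OF assms(1,3) Suc.prems(3)]]
  show ?case by simp
qed simp

text \<open>Stability of \<open>X\<close> gives a factor \<open>g\<close>. It transfers to
  \<open>Y\<close> because agreement at \<open>Suc s\<close> matches each new color in
  \<open>Y\<close> with one in \<open>X\<close>, and a new color determines the old one by
  injectivity.\<close>

lemma ord_agree_stable:
  assumes "inj H" "finite_labeled_ord_complex L X" "finite_labeled_ord_complex L Y"
    and "color_partition (cells X) (ord_ccwl_color H X (Suc s)) =
         color_partition (cells X) (ord_ccwl_color H X s)"
    and "ord_agree H X Y s" "ord_agree H X Y (Suc s)"
    and "s \<le> t"
  shows "ord_agree H X Y t"
proof -
  obtain g where g: "\<And>\<sigma>. \<sigma> \<in> cells X \<Longrightarrow>
      ord_ccwl_color H X (Suc s) \<sigma> = g (ord_ccwl_color H X s \<sigma>)"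
    using color_partition_eq_factor[OF assms(4)] by metis
  have gY: "ord_ccwl_color H Y (Suc s) \<tau> = g (ord_ccwl_color H Y s \<tau>)" if "\<tau> \<in> cells Y" for \<tau>
  proof -
    have "ord_ccwl_color H X (Suc s) ` cells X = ord_ccwl_color H Y (Suc s) ` cells Y"
      using assms(6) finite_cells[OF assms(2)] finite_cells[OF assms(3)]
      unfolding ord_agree_def by (metis finite_set_mset_mset_set set_image_mset)
    with that obtain \<sigma> where \<sigma>: "\<sigma> \<in> cells X"
        "ord_ccwl_color H Y (Suc s) \<tau> = ord_ccwl_color H X (Suc s) \<sigma>"
      by (metis imageE imageI)
    then have "ord_ccwl_color H Y s \<tau> = ord_ccwl_color H X s \<sigma>"
      using \<open>inj H\<close> by (simp add: inj_eq)
    with \<sigma> g show ?thesis by metis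
  qed
  have "ord_agree H X Y (s + (t - s))"
    using assms g gY by (intro ord_agree_factor[where L = L and g = g])
      (auto simp: finite_labeled_ord_complex_def simp del: ord_ccwl_color.simps)
  with \<open>s \<le> t\<close> show ?thesis by simp
qed

text \<open>Let \<open>s\<close> be least such that iteration \<open>Suc s\<close> leaves one of the
  partitions unchanged. Iterations up to \<open>Suc s\<close> are performed in both complexes, hence
  agree, and stability settles the later ones; without such an \<open>s\<close> every iteration is
  performed.\<close>

lemma ord_agree_if_not_distinguished:
  assumes "inj H" "finite_labeled_ord_complex L X" "finite_labeled_ord_complex L Y"
    and "\<not> ord_ccwl_distinguishes H X Y"
  shows "ord_agree H X Y t"
proof -
  let ?stX = "\<lambda>s. color_partition (cells X) (ord_ccwl_color H X (Suc s)) =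
         color_partition (cells X) (ord_ccwl_color H X s)"
  let ?stY = "\<lambda>s. color_partition (cells Y) (ord_ccwl_color H Y (Suc s)) =
         color_partition (cells Y) (ord_ccwl_color H Y s)"
  have agree: "ord_agree H X Y u" if "\<And>s. Suc s < u \<Longrightarrow> \<not> ?stX s \<and> \<not> ?stY s" for u
    using assms(4) that
    unfolding ord_ccwl_distinguishes_def distinguished_def performed_def ord_agree_def by blast
  show ?thesis
  proof (cases "\<exists>s. ?stX s \<or> ?stY s")
    case True
    define s where "s = (LEAST s. ?stX s \<or> ?stY s)"
    have st: "?stX s \<or> ?stY s"
      unfolding s_def by (rule LeastI_ex[OF True])
    have least: "\<not> ?stX r \<and> \<not> ?stY r" if "r < s" for r
      using not_less_Least[OF that[unfolded s_def]] by blast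
    \<comment> \<open>The bound includes \<open>Suc s\<close>: the iteration that reveals stability
      is still performed, and \<open>ord_agree_stable\<close> requires agreement there.\<close>
    have start: "ord_agree H X Y u" if "u \<le> Suc s" for u
      using that by (intro agree least) simp
    \<comment> \<open>This serves the case that \<open>Y\<close> is the stable complex, where the
      two complexes exchange roles.\<close>
    have sym: "ord_agree H Y X u = ord_agree H X Y u" for u
      by (auto simp: ord_agree_def)
    show ?thesis
    proof (cases "t \<le> s")
      case False
      then have "s \<le> t" by simp
      from st show ?thesis
      proof
        assume "?stX s"
        from ord_agree_stable[OF assms(1-3) this start start \<open>s \<le> t\<close>] show ?thesis by simp
      next
        assume "?stY s"
        from ord_agree_stable[OF assms(1,3,2) this _ _ \<open>s \<le> t\<close>] start show ?thesis
          by (simp add: sym del: ord_ccwl_color.simps)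
      qed
    qed (simp add: start)
  next
    case False
    then show ?thesis by (intro agree) blast
  qed
qed

text \<open>By contraposition: agreement at all Ord-CCWL iterations is pushed forward by
  \<open>coarsen\<close>, so the k-CCWL colors agree at every iteration, whenever that test
  stops.\<close>

lemma ord_distinguishes_if_k_distinguishes:
  assumes "inj H" "finite_labeled_ord_complex L X" "finite_labeled_ord_complex L Y"
    and "k_ccwl_distinguishes K X Y"
  shows "ord_ccwl_distinguishes H X Y"
proof (rule ccontr)
  assume "\<not> ord_ccwl_distinguishes H X Y"
  note agree = ord_agree_if_not_distinguished[OF assms(1-3) this]
  have labeled: "labeled_ord_complex L X" "labeled_ord_complex L Y"
    using assms(2,3) by (auto simp: finite_labeled_ord_complex_def)
  have "image_mset (k_ccwl_color K X t) (mset_set (cells X)) =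
        image_mset (k_ccwl_color K Y t) (mset_set (cells Y))" for t
    using agree[of t]
      image_mset_factor[of "cells X" "k_ccwl_color K X t" "coarsen H K t",
        OF k_color_eq_coarsen_ord_color[OF assms(1) labeled(1)]]
      image_mset_factor[of "cells Y" "k_ccwl_color K Y t" "coarsen H K t",
        OF k_color_eq_coarsen_ord_color[OF assms(1) labeled(2)]]
    by (simp add: ord_agree_def)
  with assms(4) show False
    by (simp add: k_ccwl_distinguishes_def distinguished_def)
qed

section \<open>A pair separated only by the order\<close>

text \<open>\<open>R\<close> will be inclusion or its converse; it only orders the neighborhood of \<open>{1}\<close>.\<close>

definition three_cells :: "'c \<Rightarrow> nat set rel \<Rightarrow> (nat, 'c) ord_complex" where
  "three_cells l R =
     \<lparr>vertices = {0, 1}, cells = {{0}, {0, 1}, {1}}, rk = (\<lambda>\<sigma>. card \<sigma> - 1),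
      label = (\<lambda>_. l),
      nbhd = (\<lambda>\<sigma>. if \<sigma> = {0} then {} else if \<sigma> = {0, 1} then {{0}} else {{0}, {0, 1}}),
      ord = (\<lambda>\<sigma>. if \<sigma> = {0} then {} else if \<sigma> = {0, 1} then {({0}, {0})}
                 else Restr R {{0}, {0, 1}})\<rparr>"

lemma singleton_0_1_neq [simp]:
  "{0::nat} \<noteq> {0, 1}" "{1::nat} \<noteq> {0, 1}" "{0, 1::nat} \<noteq> {0}" "{0, 1::nat} \<noteq> {1}"
  "{Suc 0} \<noteq> {0, Suc 0}" "{0::nat} \<noteq> {0, Suc 0}" "{0, Suc 0} \<noteq> {0}" "{0, Suc 0} \<noteq> {Suc 0}"
  by auto

lemma finite_labeled_three_cells:
  assumes "l \<in> L" "R = {(\<sigma>, \<tau>). \<sigma> \<subseteq> \<tau>} \<or> R = {(\<sigma>, \<tau>). \<tau> \<subseteq> \<sigma>}"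
  shows "finite_labeled_ord_complex L (three_cells l R)"
proof -
  have "linear_order_on {{0}, {0, 1}} (Restr R {{0}, {0, 1}})"
    using assms(2) by (auto simp: order_on_defs refl_on_def trans_def antisym_def total_on_def)
  moreover have "linear_order_on {{0::nat}} {({0}, {0})}"
    by (auto simp: order_on_defs refl_on_def trans_def antisym_def total_on_def)
  ultimately show ?thesis using assms(1)
    by (auto simp: finite_labeled_ord_complex_def labeled_ord_complex_def
        combinatorial_complex_def three_cells_def)
qed

lemma nbhd_list_three_cells:
  fixes l :: 'c
  shows "nbhd_list (three_cells l R) {0} = []"
    and "nbhd_list (three_cells l R) {0, 1} = [{0}]"
    and "nbhd_list (three_cells l {(\<sigma>, \<tau>). \<sigma> \<subseteq> \<tau>}) {1} = [{0}, {0, 1}]"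
    and "nbhd_list (three_cells l {(\<sigma>, \<tau>). \<tau> \<subseteq> \<sigma>}) {1} = [{0, 1}, {0}]"
  by (rule nbhd_list_eqI; auto simp: three_cells_def antisym_def)+

text \<open>For the two orders compared later, iteration 1 sees only the neighborhood sizes, so the
  difference first shows at iteration 2. That iteration is performed because the sizes 0 and 1
  already split the initial partition.\<close>

lemma performed_three_cells:
  assumes "inj H"
  shows "performed (cells (three_cells l R)) (ord_ccwl_color H (three_cells l R)) 2"
proof -
  let ?X = "three_cells l R"
  have "color_partition (cells ?X) (ord_ccwl_color H ?X (Suc 0)) \<noteq>
        color_partition (cells ?X) (ord_ccwl_color H ?X 0)"
  proof
    assume "color_partition (cells ?X) (ord_ccwl_color H ?X (Suc 0)) =
        color_partition (cells ?X) (ord_ccwl_color H ?X 0)"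
    then obtain g where g: "\<And>\<sigma>. \<sigma> \<in> cells ?X \<Longrightarrow>
        ord_ccwl_color H ?X (Suc 0) \<sigma> = g (ord_ccwl_color H ?X 0 \<sigma>)"
      using color_partition_eq_factor by metis
    have "H (l, []) = H (l, [l])"
      using g[of "{0}"] g[of "{0, 1}"] nbhd_list_three_cells(1,2)[of l R]
      by (simp add: three_cells_def)
    with \<open>inj H\<close> show False by (simp add: inj_eq)
  qed
  then show ?thesis by (auto simp: performed_def numeral_2_eq_2)
qed

lemma ord_distinguishes_three_cells:
  fixes l :: 'c
  assumes "inj H"
  shows "ord_ccwl_distinguishes H
    (three_cells l {(\<sigma>, \<tau>). \<sigma> \<subseteq> \<tau>}) (three_cells l {(\<sigma>, \<tau>). \<tau> \<subseteq> \<sigma>})"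
    (is "ord_ccwl_distinguishes H ?X ?Y")
proof -
  have cells: "cells (three_cells l R) = {{0}, {0, 1}, {1}}"
    and label: "label (three_cells l R) = (\<lambda>_. l)" for R
    by (simp_all add: three_cells_def)
  note lists = nbhd_list_three_cells[where l = l]
  have "ord_ccwl_color H ?X 2 {1} \<in> ord_ccwl_color H ?X 2 ` cells ?X"
    by (simp add: cells)
  \<comment> \<open>In \<open>?Y\<close> the cell \<open>{1}\<close> lists the same two distinct
    colors in the opposite order, and the tuples of the other cells are shorter.\<close>
  moreover have "ord_ccwl_color H ?X 2 {1} \<notin> ord_ccwl_color H ?Y 2 ` cells ?Y"
    using \<open>inj H\<close> lists by (simp add: cells label numeral_2_eq_2 inj_eq)
  ultimately have "ord_ccwl_color H ?X 2 ` cells ?X \<noteq> ord_ccwl_color H ?Y 2 ` cells ?Y"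
    by (metis (no_types))
  then have "set_mset (image_mset (ord_ccwl_color H ?X 2) (mset_set (cells ?X))) \<noteq>
      set_mset (image_mset (ord_ccwl_color H ?Y 2) (mset_set (cells ?Y)))"
    by (simp only: set_image_mset cells finite.intros finite_set_mset_mset_set not_False_eq_True)
  then have "image_mset (ord_ccwl_color H ?X 2) (mset_set (cells ?X)) \<noteq>
      image_mset (ord_ccwl_color H ?Y 2) (mset_set (cells ?Y))"
    by (rule contrapos_nn) (rule arg_cong)
  with performed_three_cells[OF assms] show ?thesis
    unfolding ord_ccwl_distinguishes_def distinguished_def by blast
qed

text \<open>\<open>R\<close> enters only through \<open>ord\<close>, which the k-CCWL update never
  reads.\<close>

lemma k_color_three_cells:
  "k_ccwl_color K (three_cells l R) t = k_ccwl_color K (three_cells l R') t"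
  by (induction t) (simp_all add: three_cells_def)

lemma not_k_distinguishes_three_cells:
  "\<not> k_ccwl_distinguishes K (three_cells l R) (three_cells l R')"
proof -
  have "cells (three_cells l R) = cells (three_cells l R')"
    by (simp add: three_cells_def)
  then show ?thesis
    by (simp add: k_ccwl_distinguishes_def distinguished_def k_color_three_cells[of K l R _ R'])
qed

theorem proposition4p2:
  fixes L :: "'c set"
    and HASH_ord :: "'c \<times> 'c list \<Rightarrow> 'c"
    and HASH_k :: "'c \<times> 'c multiset \<Rightarrow> 'c"
  assumes "L \<noteq> {}"
    and "inj HASH_ord"
    and "inj HASH_k"
  shows "(\<forall>(X :: ('v, 'c) ord_complex) (Y :: ('w, 'c) ord_complex).
            finite_labeled_ord_complex L X \<longrightarrow> finite_labeled_ord_complex L Y \<longrightarrow>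
            k_ccwl_distinguishes HASH_k X Y \<longrightarrow> ord_ccwl_distinguishes HASH_ord X Y)
       \<and> (\<exists>(X :: (nat, 'c) ord_complex) (Y :: (nat, 'c) ord_complex).
            finite_labeled_ord_complex L X \<and> finite_labeled_ord_complex L Y \<and>
            ord_ccwl_distinguishes HASH_ord X Y \<and> \<not> k_ccwl_distinguishes HASH_k X Y)"
proof (intro conjI allI impI)
  fix X :: "('v, 'c) ord_complex" and Y :: "('w, 'c) ord_complex"
  assume "finite_labeled_ord_complex L X" "finite_labeled_ord_complex L Y"
    "k_ccwl_distinguishes HASH_k X Y"
  then show "ord_ccwl_distinguishes HASH_ord X Y"
    using ord_distinguishes_if_k_distinguishes \<open>inj HASH_ord\<close> by blast
next
  obtain l where "l \<in> L" using \<open>L \<noteq> {}\<close> by blast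
  then show "\<exists>(X :: (nat, 'c) ord_complex) (Y :: (nat, 'c) ord_complex).
            finite_labeled_ord_complex L X \<and> finite_labeled_ord_complex L Y \<and>
            ord_ccwl_distinguishes HASH_ord X Y \<and> \<not> k_ccwl_distinguishes HASH_k X Y"
    by (intro exI[of _ "three_cells l {(\<sigma>, \<tau>). \<sigma> \<subseteq> \<tau>}"]
        exI[of _ "three_cells l {(\<sigma>, \<tau>). \<tau> \<subseteq> \<sigma>}"] conjI
        finite_labeled_three_cells ord_distinguishes_three_cells \<open>inj HASH_ord\<close>
        not_k_distinguishes_three_cells) simp_all
qed

end
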